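(* Let $(\mathfrak g,[\,\cdot\,,\,\cdot\,],B)$ be a quadratic Lie algebra over $\mathbb F$ and let $V$ be an $r$-dimensional vector space. Let $(\mathfrak G=\mathfrak g\oplus V,[\,\cdot\,,\,\cdot\,]_{\mathfrak G})$ be a central extension of $(\mathfrak g,[\,\cdot\,,\,\cdot\,])$ by $V$. If $(\mathfrak G,[\,\cdot\,,\,\cdot\,]_{\mathfrak G})$ admits an invariant metric $B_{\mathfrak G}$ for which $V$ is isotropic (i.e. $B_{\mathfrak G}(u,v)=0$ for all $u,v\in V$), then there exists a quadratic Hom-Lie algebra $(\mathfrak g,\mu,T,B)$, on the same vector space $\mathfrak g$ and with the same form $B$, such that $$[x,y]=T(\mu(x,y))=\mu(T(x),y)\quad\text{for all }x,y\in\mathfrak g,$$ and $\dim\operatorname{Ker}(T)=r$.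
   Context: All vector spaces are finite dimensional over an algebraically closed field $\mathbb F$ of characteristic zero. An invariant metric on a Lie algebra is a symmetric non-degenerate bilinear form $B$ with $B([x,y],z)=B(x,[y,z])$ for all $x,y,z$; a quadratic Lie algebra is a Lie algebra together with an invariant metric. A central extension of $(\mathfrak g,[\,\cdot\,,\,\cdot\,])$ by $V$ on $\mathfrak G=\mathfrak g\oplus V$ is a Lie bracket of the form $[x+u,y+v]_{\mathfrak G}=[x,y]+\theta(x,y)$ for $x,y\in\mathfrak g$, $u,v\in V$, where $\theta:\mathfrak g\times\mathfrak g\to V$ is a $2$-cocycle of $\mathfrak g$ with values in the trivial module $V$. A Hom-Lie algebra is a triple $(\mathfrak g,\mu,T)$ with $\mathfrak g$ a vector space, $\mu:\mathfrak g\times\mathfrak g\to\mathfrak g$ bilinear and skew-symmetric, and $T:\mathfrak g\to\mathfrak g$ linear, such that $\mu(T(x),\mu(y,z))+\mu(T(y),\mu(z,x))+\mu(T(z),\mu(x,y))=0$ for all $x,y,z\in\mathfrak g$. A quadratic Hom-Lie algebra $(\mathfrak g,\mu,T,B)$ is a Hom-Lie algebra with a symmetric non-degenerate bilinear form $B$ on $\mathfrak g$ such that $B(\mu(x,y),z)=B(x,\mu(y,z))$ and $B(T(x),y)=B(x,T(y))$ for all $x,y,z$. *)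

theory Defs
  imports "HOL-Analysis.Product_Vector" "HOL-Computational_Algebra.Polynomial"
begin

text \<open>
  Vector spaces are whole types with an explicit scalar multiplication, as in the locale
  \<^locale>\<open>vector_space\<close>. The library's \<^const>\<open>Vector_Spaces.linear\<close> includes the assertion that
  both scalar multiplications define vector spaces.
\<close>

definition bilinear_map ::
  "('f::field \<Rightarrow> 'a::ab_group_add \<Rightarrow> 'a) \<Rightarrow> ('f \<Rightarrow> 'b::ab_group_add \<Rightarrow> 'b) \<Rightarrow>
   ('f \<Rightarrow> 'c::ab_group_add \<Rightarrow> 'c) \<Rightarrow> ('a \<Rightarrow> 'b \<Rightarrow> 'c) \<Rightarrow> bool"
  where "bilinear_map s1 s2 s3 f \<longleftrightarrow>
    (\<forall>x. Vector_Spaces.linear s2 s3 (\<lambda>y. f x y)) \<and>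
    (\<forall>y. Vector_Spaces.linear s1 s3 (\<lambda>x. f x y))"

definition lie_algebra ::
  "('f::field \<Rightarrow> 'a::ab_group_add \<Rightarrow> 'a) \<Rightarrow> ('a \<Rightarrow> 'a \<Rightarrow> 'a) \<Rightarrow> bool"
  where "lie_algebra s br \<longleftrightarrow>
    bilinear_map s s s br \<and>
    (\<forall>x. br x x = 0) \<and>
    (\<forall>x y z. br x (br y z) + br y (br z x) + br z (br x y) = 0)"

definition symmetric_nondegenerate_form ::
  "('f::field \<Rightarrow> 'a::ab_group_add \<Rightarrow> 'a) \<Rightarrow> ('a \<Rightarrow> 'a \<Rightarrow> 'f) \<Rightarrow> bool"
  where "symmetric_nondegenerate_form s B \<longleftrightarrow>
    bilinear_map s s (*) B \<and>
    (\<forall>x y. B x y = B y x) \<and>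
    (\<forall>x. (\<forall>y. B x y = 0) \<longrightarrow> x = 0)"

definition invariant_metric ::
  "('f::field \<Rightarrow> 'a::ab_group_add \<Rightarrow> 'a) \<Rightarrow> ('a \<Rightarrow> 'a \<Rightarrow> 'a) \<Rightarrow> ('a \<Rightarrow> 'a \<Rightarrow> 'f) \<Rightarrow> bool"
  where "invariant_metric s br B \<longleftrightarrow>
    symmetric_nondegenerate_form s B \<and>
    (\<forall>x y z. B (br x y) z = B x (br y z))"

definition quadratic_lie_algebra ::
  "('f::field \<Rightarrow> 'a::ab_group_add \<Rightarrow> 'a) \<Rightarrow> ('a \<Rightarrow> 'a \<Rightarrow> 'a) \<Rightarrow> ('a \<Rightarrow> 'a \<Rightarrow> 'f) \<Rightarrow> bool"
  where "quadratic_lie_algebra s br B \<longleftrightarrow> lie_algebra s br \<and> invariant_metric s br B"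

definition two_cocycle ::
  "('f::field \<Rightarrow> 'a::ab_group_add \<Rightarrow> 'a) \<Rightarrow> ('a \<Rightarrow> 'a \<Rightarrow> 'a) \<Rightarrow>
   ('f \<Rightarrow> 'v::ab_group_add \<Rightarrow> 'v) \<Rightarrow> ('a \<Rightarrow> 'a \<Rightarrow> 'v) \<Rightarrow> bool"
  where "two_cocycle s br sV \<theta> \<longleftrightarrow>
    bilinear_map s s sV \<theta> \<and>
    (\<forall>x. \<theta> x x = 0) \<and>
    (\<forall>x y z. \<theta> (br x y) z + \<theta> (br y z) x + \<theta> (br z x) y = 0)"

text \<open>
  The direct sum of \<open>'a\<close> and \<open>'v\<close> is the product type, \<open>x + u\<close> being the pair \<open>(x, u)\<close>.
\<close>

definition central_extension ::
  "('f::field \<Rightarrow> 'a::ab_group_add \<Rightarrow> 'a) \<Rightarrow> ('a \<Rightarrow> 'a \<Rightarrow> 'a) \<Rightarrow>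
   ('f \<Rightarrow> 'v::ab_group_add \<Rightarrow> 'v) \<Rightarrow> ('a \<times> 'v \<Rightarrow> 'a \<times> 'v \<Rightarrow> 'a \<times> 'v) \<Rightarrow> bool"
  where "central_extension s br sV brG \<longleftrightarrow>
    lie_algebra (module_prod.scale s sV) brG \<and>
    (\<exists>\<theta>. two_cocycle s br sV \<theta> \<and> (\<forall>x y u v. brG (x, u) (y, v) = (br x y, \<theta> x y)))"

definition hom_lie_algebra ::
  "('f::field \<Rightarrow> 'a::ab_group_add \<Rightarrow> 'a) \<Rightarrow> ('a \<Rightarrow> 'a \<Rightarrow> 'a) \<Rightarrow> ('a \<Rightarrow> 'a) \<Rightarrow> bool"
  where "hom_lie_algebra s \<mu> T \<longleftrightarrow>
    bilinear_map s s s \<mu> \<and>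
    (\<forall>x y. \<mu> x y = - \<mu> y x) \<and>
    Vector_Spaces.linear s s T \<and>
    (\<forall>x y z. \<mu> (T x) (\<mu> y z) + \<mu> (T y) (\<mu> z x) + \<mu> (T z) (\<mu> x y) = 0)"

definition quadratic_hom_lie_algebra ::
  "('f::field \<Rightarrow> 'a::ab_group_add \<Rightarrow> 'a) \<Rightarrow> ('a \<Rightarrow> 'a \<Rightarrow> 'a) \<Rightarrow> ('a \<Rightarrow> 'a) \<Rightarrow>
   ('a \<Rightarrow> 'a \<Rightarrow> 'f) \<Rightarrow> bool"
  where "quadratic_hom_lie_algebra s \<mu> T B \<longleftrightarrow>
    hom_lie_algebra s \<mu> T \<and>
    symmetric_nondegenerate_form s B \<and>
    (\<forall>x y z. B (\<mu> x y) z = B x (\<mu> y z)) \<and>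
    (\<forall>x y. B (T x) y = B x (T y))"

end

theory Submission
  imports Defs
begin

text \<open>
  Let \<open>h\<close> be the adjoint of the projection \<open>G \<rightarrow> g\<close> with respect to the two metrics,
  so \<open>BG (h x) z = B x (fst z)\<close>. It is injective with image the orthogonal complement of \<open>V\<close>.
  Put \<open>T = fst \<circ> h\<close>. As \<open>V\<close> is central, brackets in \<open>G\<close> are orthogonal to \<open>V\<close>, so they
  factor as \<open>[x, y]\<^sub>G = h (\<mu> x y)\<close> for a unique \<open>\<mu>\<close>; all identities follow by applying the
  injective map \<open>h\<close>. As \<open>V\<close> is isotropic, it lies in the image of \<open>h\<close>, which therefore maps
  the kernel of \<open>T\<close> isomorphically onto \<open>V\<close>.
\<close>

lemma bilinear_mapD:
  assumes "bilinear_map s1 s2 s3 f"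
  shows "f (x + x') y = f x y + f x' y" "f x (y + y') = f x y + f x y'"
    "f (s1 c x) y = s3 c (f x y)" "f x (s2 c y) = s3 c (f x y)"
    "f (x - x') y = f x y - f x' y" "f x 0 = 0"
proof -
  interpret l: Vector_Spaces.linear s1 s3 "\<lambda>x. f x y"
    using assms by (simp add: bilinear_map_def)
  interpret r: Vector_Spaces.linear s2 s3 "\<lambda>y. f x y"
    using assms by (simp add: bilinear_map_def)
  show "f (x + x') y = f x y + f x' y" "f x (y + y') = f x y + f x y'"
    "f (s1 c x) y = s3 c (f x y)" "f x (s2 c y) = s3 c (f x y)"
    "f (x - x') y = f x y - f x' y" "f x 0 = 0"
    by (rule l.add r.add l.scale r.scale l.diff r.zero)+
qed

lemma linearI_vector_space:
  assumes "vector_space s1" "vector_space s2"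
    "\<And>x y. f (x + y) = f x + f y" "\<And>c x. f (s1 c x) = s2 c (f x)"
  shows "Vector_Spaces.linear s1 s2 f"
  using assms
  by (simp add: Vector_Spaces.linear_def module_hom_def module_hom_axioms_def module_iff_vector_space)

lemma symmetric_nondegenerate_form_eqI:
  assumes "symmetric_nondegenerate_form s B" "\<And>z. B x z = B y z"
  shows "x = y"
proof -
  have "B (x - y) z = 0" for z
  proof -
    have "bilinear_map s s (*) B"
      using assms(1) by (simp add: symmetric_nondegenerate_form_def)
    then show ?thesis
      by (simp add: bilinear_mapD(5) assms(2))
  qed
  then show ?thesis
    using assms(1) unfolding symmetric_nondegenerate_form_def by (metis eq_iff_diff_eq_0)
qed

context finite_dimensional_vector_space
begin

text \<open>The map \<open>\<Phi>\<close> records the values of \<open>B x\<close> on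
  \<open>Basis\<close> as coordinates of a vector of the same space. Nondegeneracy makes it
  injective, so by finite dimension it is onto; a preimage of the vector with coordinates
  \<open>f b\<close> represents \<open>f\<close>. Working with an endomorphism avoids the dual
  space.\<close>

lemma symmetric_nondegenerate_form_represents:
  assumes B: "symmetric_nondegenerate_form scale B"
    and f: "Vector_Spaces.linear scale (*) f"
  obtains x where "\<And>y. B x y = f y"
proof -
  have bil: "bilinear_map scale scale (*) B"
    using B by (simp add: symmetric_nondegenerate_form_def)
  have eq_on_Basis: "g = g'"
    if "Vector_Spaces.linear scale (*) g" "Vector_Spaces.linear scale (*) g'"
      "\<And>b. b \<in> Basis \<Longrightarrow> g b = g' b" for g g' :: "'b \<Rightarrow> 'a"
  proof -
    interpret vector_space_pair scale "(*) :: 'a \<Rightarrow> 'a \<Rightarrow> 'a"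
      using that(1) unfolding Vector_Spaces.linear_def vector_space_pair_def by blast
    show ?thesis
      using linear_eq_on[OF that(1,2), of _ Basis] that(3) span_Basis by auto
  qed
  have lin: "Vector_Spaces.linear scale (*) (B x)" for x
    using bil by (simp add: bilinear_map_def)
  have coeff_eq: "u b = w b"
    if eq: "(\<Sum>b\<in>Basis. scale (u b) b) = (\<Sum>b\<in>Basis. scale (w b) b)" and b: "b \<in> Basis"
    for u w b
  proof -
    have "(\<Sum>b\<in>Basis. scale (u b - w b) b) = 0"
      using eq by (simp add: scale_left_diff_distrib sum_subtractf)
    then have "u b - w b = 0"
      using independentD[OF independent_Basis finite_Basis subset_refl] b by fast
    then show ?thesis by simp
  qed
  define \<Phi> where "\<Phi> x = (\<Sum>b\<in>Basis. scale (B x b) b)" for x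
  have "Vector_Spaces.linear scale scale \<Phi>"
    by (rule linearI_vector_space)
      (simp_all add: vector_space_axioms \<Phi>_def bilinear_mapD[OF bil] scale_left_distrib
        sum.distrib scale_sum_right)
  moreover have "inj \<Phi>"
  proof (rule injI)
    fix x y assume "\<Phi> x = \<Phi> y"
    then have "B x b = B y b" if "b \<in> Basis" for b
      using coeff_eq[OF _ that] by (simp add: \<Phi>_def)
    then have "B x = B y"
      using eq_on_Basis[OF lin lin] by simp
    then show "x = y"
      by (auto intro: symmetric_nondegenerate_form_eqI[OF B])
  qed
  ultimately have "surj \<Phi>"
    by (rule linear_inj_imp_surj)
  then obtain x where "\<Phi> x = (\<Sum>b\<in>Basis. scale (f b) b)"
    by (metis surjD)
  then have "B x b = f b" if "b \<in> Basis" for b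
    using coeff_eq[OF _ that] by (simp add: \<Phi>_def)
  then have "B x = f"
    using eq_on_Basis[OF lin f] by simp
  then have "B x y = f y" for y
    by simp
  then show thesis
    by (rule that)
qed

text \<open>For each \<open>x\<close>, the vector \<open>h x\<close> represents the functional
  sending \<open>z\<close> to \<open>C x (p z)\<close>. Nondegeneracy makes this vector unique, and
  linearity of \<open>h\<close> follows from uniqueness.\<close>

lemma adjoint_exists:
  assumes B: "symmetric_nondegenerate_form scale B"
    and C: "bilinear_map s s (*) C"
    and p: "Vector_Spaces.linear scale s p"
  obtains h where "Vector_Spaces.linear s scale h" "\<And>x z. B (h x) z = C x (p z)"
proof -
  have bil: "bilinear_map scale scale (*) B"
    using B by (simp add: symmetric_nondegenerate_form_def)
  interpret p: Vector_Spaces.linear scale s p by (rule p)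
  have vs: "vector_space ((*) :: 'a \<Rightarrow> 'a \<Rightarrow> 'a)"
    by unfold_locales (simp_all add: algebra_simps)
  have "Vector_Spaces.linear scale (*) (\<lambda>z. C x (p z))" for x
    by (rule linearI_vector_space)
      (simp_all add: vector_space_axioms vs bilinear_mapD[OF C] p.add p.scale)
  then have "\<exists>h. \<forall>z. B h z = C x (p z)" for x
    using symmetric_nondegenerate_form_represents[OF B] by metis
  then obtain h where h: "\<And>x z. B (h x) z = C x (p z)"
    by metis
  have "Vector_Spaces.linear s scale h"
    by (rule linearI_vector_space; (rule symmetric_nondegenerate_form_eqI[OF B])?)
      (simp_all add: vector_space_axioms p.vs2.vector_space_axioms h bilinear_mapD[OF bil]
        bilinear_mapD[OF C])
  then show thesis
    using that h by blast
qed

end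

theorem theorem3p1:
  fixes sg :: "'f::{alg_closed_field, field_char_0} \<Rightarrow> 'g::ab_group_add \<Rightarrow> 'g"
    and sV :: "'f \<Rightarrow> 'v::ab_group_add \<Rightarrow> 'v"
    and basis_g :: "'g set" and basis_V :: "'v set"
    and br :: "'g \<Rightarrow> 'g \<Rightarrow> 'g"
    and B :: "'g \<Rightarrow> 'g \<Rightarrow> 'f"
    and brG :: "'g \<times> 'v \<Rightarrow> 'g \<times> 'v \<Rightarrow> 'g \<times> 'v"
    and BG :: "'g \<times> 'v \<Rightarrow> 'g \<times> 'v \<Rightarrow> 'f"
    and r :: nat
  assumes "finite_dimensional_vector_space sg basis_g"
    and "finite_dimensional_vector_space sV basis_V"
    and "vector_space.dim sV (UNIV :: 'v set) = r"
    and "quadratic_lie_algebra sg br B"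
    and "central_extension sg br sV brG"
    and "invariant_metric (module_prod.scale sg sV) brG BG"
    and "\<forall>u v. BG (0, u) (0, v) = 0"
  shows "\<exists>\<mu> T. quadratic_hom_lie_algebra sg \<mu> T B \<and>
           (\<forall>x y. br x y = T (\<mu> x y) \<and> T (\<mu> x y) = \<mu> (T x) y) \<and>
           vector_space.dim sg {x. T x = 0} = r"
proof -
  interpret g: finite_dimensional_vector_space sg basis_g by fact
  interpret V: finite_dimensional_vector_space sV basis_V by fact
  interpret G: finite_dimensional_vector_space_prod sg sV basis_g basis_V
    by unfold_locales
  let ?sG = "module_prod.scale sg sV"
  interpret gG: finite_dimensional_vector_space_pair_1 sg basis_g ?sG
    by unfold_locales
  interpret VG: finite_dimensional_vector_space_pair_1 sV basis_V ?sG
    by unfold_locales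

  have form: "symmetric_nondegenerate_form sg B"
    and inv: "\<And>x y z. B (br x y) z = B x (br y z)"
    using assms(4) by (auto simp: quadratic_lie_algebra_def invariant_metric_def)
  then have bil: "bilinear_map sg sg (*) B" and sym: "\<And>x y. B x y = B y x"
    by (auto simp: symmetric_nondegenerate_form_def)
  have formG: "symmetric_nondegenerate_form ?sG BG"
    and invG: "\<And>x y z. BG (brG x y) z = BG x (brG y z)"
    using assms(6) by (auto simp: invariant_metric_def)
  then have bilG: "bilinear_map ?sG ?sG (*) BG" and symG: "\<And>x y. BG x y = BG y x"
    by (auto simp: symmetric_nondegenerate_form_def)
  have bil_brG: "bilinear_map ?sG ?sG ?sG brG"
    and alt: "\<And>x. brG x x = 0"
    and jac: "\<And>x y z. brG x (brG y z) + brG y (brG z x) + brG z (brG x y) = 0"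
    using assms(5) by (auto simp: central_extension_def lie_algebra_def)
  obtain \<theta> where \<theta>: "\<And>x y u v. brG (x, u) (y, v) = (br x y, \<theta> x y)"
    using assms(5) by (auto simp: central_extension_def)
  have fst_brG: "fst (brG a b) = br (fst a) (fst b)" for a b
    by (cases a; cases b) (simp add: \<theta>)
  \<comment> \<open>This is the centrality of \<open>V\<close>: a bracket ignores the
    \<open>V\<close>-components of its arguments.\<close>
  have brG_lift: "brG a b = brG (fst a, 0) (fst b, 0)" for a b
    by (cases a; cases b) (simp add: \<theta>)
  have skewG: "brG a b = - brG b a" for a b
    using alt[of "a + b"] alt[of a] alt[of b]
    by (simp add: bilinear_mapD[OF bil_brG] eq_neg_iff_add_eq_0 add.commute)

  \<comment> \<open>The adjoint of the projection, its injectivity and its range\<close>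
  obtain h where lin_h: "Vector_Spaces.linear sg ?sG h"
    and h: "\<And>x z. BG (h x) z = B x (fst z)"
    using G.p.adjoint_exists[OF formG bil G.linear_fst] by blast
  interpret h: Vector_Spaces.linear sg ?sG h by (rule lin_h)
  have inj_h: "inj h"
  proof (rule injI)
    fix x y assume "h x = h y"
    then have "B x z = B y z" for z
      using h[of x "(z, 0)"] h[of y "(z, 0)"] by simp
    then show "x = y"
      by (rule symmetric_nondegenerate_form_eqI[OF form])
  qed
  have h_eqD: "x = y" if "h x = h y" for x y
    using that inj_h by (simp add: inj_eq)
  \<comment> \<open>If \<open>w\<close> is orthogonal to \<open>V\<close>, then \<open>BG w\<close>
    depends only on first components. It is therefore a functional on \<open>g\<close> composed with
    \<open>fst\<close>, and the \<open>x\<close> representing that functional under \<open>B\<close>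
    satisfies \<open>h x = w\<close>.\<close>
  have range_h: "\<exists>x. h x = w" if w: "\<And>v. BG w (0, v) = 0" for w
  proof -
    have "Vector_Spaces.linear sg (*) (\<lambda>y. BG w (y, 0))"
    proof (rule linearI_vector_space)
      show "vector_space ((*) :: 'f \<Rightarrow> 'f \<Rightarrow> 'f)"
        by unfold_locales (simp_all add: algebra_simps)
      show "BG w (x + y, 0) = BG w (x, 0) + BG w (y, 0)" for x y
        using bilinear_mapD(2)[OF bilG, of w "(x, 0)" "(y, 0)"] by simp
      show "BG w (sg c x, 0) = c * BG w (x, 0)" for c x
        using bilinear_mapD(4)[OF bilG, of w c "(x, 0)"] by (simp add: G.scale_prod)
    qed (rule g.vector_space_axioms)
    then obtain x where x: "\<And>y. B x y = BG w (y, 0)"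
      using g.symmetric_nondegenerate_form_represents[OF form] by metis
    have "BG (h x) z = BG w z" for z
      using bilinear_mapD(2)[OF bilG, of w "(fst z, 0)" "(0, snd z)"] w[of "snd z"]
      by (simp add: h x)
    then show ?thesis
      using symmetric_nondegenerate_form_eqI[OF formG] by blast
  qed

  have "\<exists>m. h m = brG (x, 0) (y, 0)" for x y
  proof (rule range_h)
    fix v
    \<comment> \<open>Invariance moves the vector of \<open>V\<close> into a bracket, where
      centrality kills it.\<close>
    have "brG (y, 0) (0, v) = 0"
      using brG_lift[of "(y, 0)" "(0, v)"] bilinear_mapD(6)[OF bil_brG, of "(y, 0)"]
      by (simp add: zero_prod_def)
    then show "BG (brG (x, 0) (y, 0)) (0, v) = 0"
      by (simp add: invG bilinear_mapD(6)[OF bilG])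
  qed
  then obtain \<mu> where "\<And>x y. h (\<mu> x y) = brG (x, 0) (y, 0)"
    by metis
  then have \<mu>: "h (\<mu> (fst a) (fst b)) = brG a b" for a b
    by (metis brG_lift)
  have \<mu>': "h (\<mu> x y) = brG (x, 0) (y, 0)" for x y
    using \<mu>[of "(x, 0)" "(y, 0)"] by simp
  define T where "T x = fst (h x)" for x

  \<comment> \<open>Identities for \<mu> and \<open>T\<close>\<close>
  have T\<mu>: "T (\<mu> x y) = br x y" for x y
    by (simp add: T_def \<mu>' fst_brG)
  have \<mu>T: "\<mu> (T x) y = br x y" for x y
  proof (rule h_eqD, rule symmetric_nondegenerate_form_eqI[OF formG])
    fix z
    \<comment> \<open>Since \<open>T x = fst (h x)\<close>, the left side is
      \<open>BG (brG (h x) (y, 0)) z\<close>. By the two invariances and the adjoint property, both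
      sides equal \<open>B x (br y (fst z))\<close>.\<close>
    show "BG (h (\<mu> (T x) y)) z = BG (h (br x y)) z"
      using \<mu>[of "h x" "(y, 0)"] by (simp add: T_def invG h fst_brG inv)
  qed
  have skew: "\<mu> x y = - \<mu> y x" for x y
    by (rule h_eqD) (simp add: h.neg \<mu>' skewG[of "(x, 0)"])
  have \<mu>T_right: "\<mu> x (T y) = br x y" for x y
  proof -
    have "br x y = - br y x"
      using arg_cong[OF skewG[of "(x, 0)" "(y, 0)"], of fst] by (simp add: fst_brG)
    then show ?thesis
      using skew[of x "T y"] \<mu>T[of y x] by simp
  qed
  have pair_add: "(x + y, 0 :: 'v) = (x, 0) + (y, 0)" for x y :: 'g by simp
  have pair_scale: "(sg c x, 0 :: 'v) = ?sG c (x, 0)" for c x by (simp add: G.scale_prod)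
  have bil_\<mu>: "bilinear_map sg sg sg \<mu>"
    unfolding bilinear_map_def
    by (intro conjI allI linearI_vector_space g.vector_space_axioms; rule h_eqD)
      (simp_all only: h.add h.scale \<mu>' pair_add pair_scale bilinear_mapD[OF bil_brG])
  have lin_T: "Vector_Spaces.linear sg sg T"
    by (rule linearI_vector_space)
      (simp_all add: g.vector_space_axioms T_def h.add h.scale G.scale_def)
  have hom_jac: "\<mu> (T x) (\<mu> y z) + \<mu> (T y) (\<mu> z x) + \<mu> (T z) (\<mu> x y) = 0" for x y z
  proof (rule h_eqD)
    \<comment> \<open>Moving \<open>T\<close> from the first argument to the second, where it turns
      \<mu> into \<open>br\<close>, makes each term an iterated bracket in \<open>G\<close> after
      applying \<open>h\<close>. The Hom-Jacobi identity is thus the Jacobi identity of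
      \<open>brG\<close>.\<close>
    have "h (\<mu> (T x) (\<mu> y z)) = brG (x, 0) (brG (y, 0) (z, 0))" for x y z
    proof -
      have "\<mu> (T x) (\<mu> y z) = \<mu> x (br y z)"
        using \<mu>T[of x "\<mu> y z"] \<mu>T_right[of x "\<mu> y z"] by (simp add: T\<mu>)
      then show ?thesis
        using \<mu>[of "(x, 0)" "brG (y, 0) (z, 0)"] by (simp add: fst_brG)
    qed
    then show "h (\<mu> (T x) (\<mu> y z) + \<mu> (T y) (\<mu> z x) + \<mu> (T z) (\<mu> x y)) = h 0"
      by (simp add: h.add h.zero jac)
  qed
  \<comment> \<open>Through \<open>h\<close>, both sides become values of the trilinear form
    \<open>BG (brG a b) c\<close>, which is cyclic by invariance and symmetry of
    \<open>BG\<close>.\<close>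
  have inv_\<mu>: "B (\<mu> x y) z = B x (\<mu> y z)" for x y z
  proof -
    have "B (\<mu> x y) z = BG (brG (x, 0) (y, 0)) (z, 0)"
      using h[of "\<mu> x y" "(z, 0)"] by (simp add: \<mu>')
    also have "\<dots> = BG (brG (y, 0) (z, 0)) (x, 0)"
      using invG[of "(x, 0)" "(y, 0)"] symG[of "(x, 0)"] by simp
    also have "\<dots> = B (\<mu> y z) x"
      using h[of "\<mu> y z" "(x, 0)"] by (simp add: \<mu>')
    finally show ?thesis by (simp add: sym)
  qed
  \<comment> \<open>\<open>T\<close> is the projection composed with its own adjoint, so both sides
    are \<open>BG (h x) (h y)\<close> up to symmetry.\<close>
  have T_self_adjoint: "B (T x) y = B x (T y)" for x y
  proof -
    have "B (T x) y = BG (h y) (h x)"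
      by (simp add: h T_def sym)
    also have "\<dots> = B x (T y)"
      using symG[of "h y" "h x"] h[of x "h y"] by (simp add: T_def)
    finally show ?thesis .
  qed

  \<comment> \<open>Dimension of the kernel of \<open>T\<close>\<close>
  have "h ` {x. T x = 0} = range (Pair 0)"
  proof (rule set_eqI)
    fix w
    show "w \<in> h ` {x. T x = 0} \<longleftrightarrow> w \<in> range (Pair 0)"
    proof
      assume "w \<in> range (Pair 0)"
      then obtain u where u: "w = (0, u)" by auto
      \<comment> \<open>Isotropy says that \<open>(0, u)\<close> is orthogonal to \<open>V\<close>,
        which is the hypothesis of \<open>range_h\<close>.\<close>
      then obtain x where "h x = w"
        using range_h[of w] assms(7) by auto
      with u show "w \<in> h ` {x. T x = 0}"
        by (auto simp: T_def intro!: image_eqI[of _ _ x])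
    next
      assume "w \<in> h ` {x. T x = 0}"
      then have "w = (0, snd w)"
        by (auto simp: T_def prod_eq_iff)
      then show "w \<in> range (Pair 0)"
        by (rule ssubst) (rule rangeI)
    qed
  qed
  moreover have "G.p.dim (h ` {x. T x = 0}) = g.dim {x. T x = 0}"
    using inj_h by (intro gG.dim_image_eq lin_h) (auto intro: inj_on_subset)
  moreover have "G.p.dim (range (Pair 0 :: 'v \<Rightarrow> 'g \<times> 'v)) = V.dim (UNIV :: 'v set)"
    by (intro VG.dim_image_eq linearI_vector_space)
      (auto simp: G.p.vector_space_axioms V.vector_space_axioms G.scale_prod inj_on_def)
  ultimately have "g.dim {x. T x = 0} = r"
    using assms(3) by simp
  moreover have "quadratic_hom_lie_algebra sg \<mu> T B"
    unfolding quadratic_hom_lie_algebra_def hom_lie_algebra_def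
    by (intro conjI allI bil_\<mu> skew lin_T hom_jac form inv_\<mu> T_self_adjoint)
  ultimately show ?thesis
    using T\<mu> \<mu>T by metis
qed

end
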